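(* Let $n\ge 2$ and $b$ be integers with $b\ge n-1$. Then the real roots of the characteristic polynomial $\chi_{\mathcal{B}_n^{[0,b]}}(t)$ (respectively $\chi_{\mathcal{B}_n^{[-b,0]}}(t)$) are as follows: (1) if $n$ is odd, it has a single real root, namely $0$, of multiplicity one; (2) if $n$ is even, it has exactly two real roots, $0$ and $\frac{n(b+1)}{2}$, each of multiplicity one.
   Context: For integers $c\le d$, $\mathcal{B}_n^{[c,d]}$ is the hyperplane arrangement in $\mathbb{R}^n$ consisting of the hyperplanes $x_i-x_j=s$ for $1\le i<j\le n$ and integers $c\le s\le d$. The characteristic polynomial of an arrangement $\mathcal{A}$ in $\mathbb{R}^n$ is $\chi_{\mathcal{A}}(t)=\sum(-1)^{|\mathcal{B}|}t^{\dim(\bigcap_{H\in\mathcal{B}}H)}$ over subsets $\mathcal{B}\subseteq\mathcal{A}$ with nonempty intersection. *)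

theory Defs
  imports "HOL-Analysis.Analysis" "HOL-Computational_Algebra.Polynomial"
begin

definition deformation_arrangement ::
    "int \<Rightarrow> int \<Rightarrow> (real, 'n::{finite,linorder}) vec set set" where
  "deformation_arrangement c d =
     {{x. x $ i - x $ j = of_int s} | i j s. i < j \<and> c \<le> s \<and> s \<le> d}"

text \<open>The empty subarrangement has intersection \<^term>\<open>UNIV\<close>. For a nonempty intersection
  \<^const>\<open>aff_dim\<close> is nonnegative and is its dimension as a flat.\<close>

definition characteristic_polynomial :: "'a::euclidean_space set set \<Rightarrow> real poly" where
  "characteristic_polynomial A =
     (\<Sum>B | B \<subseteq> A \<and> \<Inter>B \<noteq> {}. monom ((-1) ^ card B) (nat (aff_dim (\<Inter>B))))"

text \<open>Finiteness, so that the sum above ranges over a finite set of subarrangements.\<close>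

lemma finite_deformation_arrangement:
  "finite (deformation_arrangement c d :: (real, 'n::{finite,linorder}) vec set set)"
proof -
  have "deformation_arrangement c d \<subseteq>
      (\<lambda>(i, j, s). {x :: (real, 'n) vec. x $ i - x $ j = of_int s}) ` (UNIV \<times> UNIV \<times> {c..d})"
    unfolding deformation_arrangement_def by force
  then show ?thesis
    by (rule finite_subset) simp
qed

end

theory Submission
  imports Defs
begin

text \<open>
  For large \<open>q\<close> the value \<open>\<chi>(q)\<close> counts the placements of the labels on a cycle of \<open>q\<close> cells with
  \<open>x i - x j\<close> not in \<open>{0..b}\<close> modulo \<open>q\<close> for \<open>i < j\<close>. Rotate the least label to cell \<open>0\<close> and write
  the gap following label \<open>i\<close> as \<open>y i + b \<sigma> i\<close> with \<open>1 \<le> y i \<le> b\<close>. The placement is proper iff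
  \<open>\<sigma> i \<ge> 1\<close> at every descent, so reading each \<open>\<sigma> i\<close> as a number of separators sorts the labels into
  \<open>J = (q - \<Sum>y) / b\<close> boxes, increasing inside each box. Hence, for every residue \<open>r\<close> modulo \<open>b\<close>,
  \<open>\<chi>(t) = t f(t)\<close> with \<open>f(t) = \<Sum>y. ((t - \<Sum>y) / b) ^ (n - 1)\<close>, where \<open>y\<close> ranges over the
  functions into \<open>{1..b}\<close> with total congruent to \<open>r\<close>. If \<open>n\<close> is odd this is a sum of even powers
  and positive. If \<open>n\<close> is even, \<open>f\<close> is strictly increasing with positive derivative, and for \<open>r = n / 2\<close>
  it is antisymmetric about \<open>n (b + 1) / 2\<close>.
\<close>

section \<open>Systems of difference equations\<close>

text \<open>The subgroup \<open>H\<close> lets one argument serve twice: \<open>{0}\<close> gives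
  equations over the reals, \<open>multiples q\<close> gives congruences modulo
  \<open>q\<close>.\<close>

definition edge_solution :: "'a::ring_1 set \<Rightarrow> ('n \<times> 'n \<times> int) set \<Rightarrow> ('n \<Rightarrow> 'a) \<Rightarrow> bool" where
  "edge_solution H E x \<longleftrightarrow> (\<forall>(i, j, s) \<in> E. x i - x j - of_int s \<in> H)"

definition rooted_solution :: "'a::ring_1 set \<Rightarrow> ('n \<Rightarrow> 'n) \<Rightarrow> ('n \<Rightarrow> int) \<Rightarrow> ('n \<Rightarrow> 'a) \<Rightarrow> bool" where
  "rooted_solution H r h x \<longleftrightarrow> (\<forall>i. x i - x (r i) - of_int (h i) \<in> H)"

definition additive_subgroup :: "'a::ring_1 set \<Rightarrow> bool" where
  "additive_subgroup H \<longleftrightarrow> 0 \<in> H \<and> (\<forall>a\<in>H. \<forall>b\<in>H. a - b \<in> H)"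

lemma additive_subgroup_add:
  assumes "additive_subgroup H" "a \<in> H" "b \<in> H"
  shows "a + b \<in> H"
proof -
  have "0 - b \<in> H" using assms unfolding additive_subgroup_def by blast
  then have "a - (0 - b) \<in> H" using assms unfolding additive_subgroup_def by blast
  then show ?thesis by simp
qed

lemma additive_subgroup_diff:
  "additive_subgroup H \<Longrightarrow> a \<in> H \<Longrightarrow> b \<in> H \<Longrightarrow> a - b \<in> H"
  unfolding additive_subgroup_def by blast

text \<open>Inside one component both values are tied to the same root, so \<open>x u - x v\<close>
  is fixed modulo \<open>H\<close>; a further edge there is either redundant or
  contradictory.\<close>

lemma rooted_solution_same_root:
  assumes H: "additive_subgroup H" and sol: "rooted_solution H r h x" and "r u = r v"
  shows "x u - x v - of_int s \<in> H \<longleftrightarrow> of_int (h u - h v - s) \<in> H"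
proof -
  have "x u - x (r u) - of_int (h u) \<in> H" "x v - x (r u) - of_int (h v) \<in> H"
    using sol \<open>r u = r v\<close> unfolding rooted_solution_def by metis+
  from additive_subgroup_diff[OF H this] have d: "x u - x v - of_int (h u - h v) \<in> H"
    by (simp add: algebra_simps)
  have "x u - x v - of_int s = (x u - x v - of_int (h u - h v)) + of_int (h u - h v - s)"
    "of_int (h u - h v - s) = (x u - x v - of_int s) - (x u - x v - of_int (h u - h v))"
    by (simp_all add: algebra_simps)
  then show ?thesis
    using d additive_subgroup_add[OF H] additive_subgroup_diff[OF H] by metis
qed

text \<open>An edge between two components hangs the component of \<open>u\<close> below the root of
  \<open>v\<close>. Modulo \<open>H\<close> one has x (r u) = x u - h u = x v + s - h u = x (r v) +
  h v + s - h u, which is the correction added to the offsets.\<close>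

lemma rooted_solution_merge:
  assumes H: "additive_subgroup H"
    and idem: "\<And>i. r (r i) = r i" and root: "\<And>i. r i = i \<Longrightarrow> h i = 0"
    and "r u \<noteq> r v"
  shows "rooted_solution H r h x \<and> x u - x v - of_int s \<in> H \<longleftrightarrow>
    rooted_solution H (\<lambda>k. if r k = r u then r v else r k)
      (\<lambda>k. if r k = r u then h k + s + h v - h u else h k) x"
    (is "?L \<longleftrightarrow> rooted_solution H ?r ?h x")
proof
  assume L: ?L
  then have e: "x k - x (r k) - of_int (h k) \<in> H" for k
    unfolding rooted_solution_def by blast
  show "rooted_solution H ?r ?h x"
    unfolding rooted_solution_def
  proof
    fix k
    show "x k - x (?r k) - of_int (?h k) \<in> H"
    proof (cases "r k = r u")
      case True
      \<comment> \<open>Walk from \<open>k\<close> to the common root, back to \<open>u\<close>,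
        across the new edge to \<open>v\<close>, and on to the root of \<open>v\<close>.\<close>
      have "(x k - x (r k) - of_int (h k)) - (x u - x (r u) - of_int (h u))
          + (x u - x v - of_int s) + (x v - x (r v) - of_int (h v)) \<in> H"
        using L additive_subgroup_add[OF H additive_subgroup_add[OF H
            additive_subgroup_diff[OF H e e]] e] by blast
      then show ?thesis using True by (simp add: algebra_simps)
    qed (use e in auto)
  qed
next
  assume R: "rooted_solution H ?r ?h x"
  then have e: "x k - x (?r k) - of_int (?h k) \<in> H" for k
    unfolding rooted_solution_def by blast
  \<comment> \<open>At the old root \<open>r u\<close> the offset is 0, so the merged equation there
    relates the two old roots; subtracting it recovers the old equations.\<close>
  have ru: "x (r u) - x (r v) - of_int (s + h v - h u) \<in> H"
    using e[of "r u"] idem root[of "r u"] by simp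
  have "x k - x (r k) - of_int (h k) \<in> H" for k
  proof (cases "r k = r u")
    case True
    have "x k - x (r v) - of_int (h k + s + h v - h u) \<in> H"
      using e[of k] True by simp
    from additive_subgroup_diff[OF H this ru] show ?thesis
      using True by (simp add: algebra_simps)
  qed (use e[of k] in auto)
  moreover have "x u - x v - of_int s \<in> H"
    using additive_subgroup_diff[OF H e[of u] e[of v]] \<open>r u \<noteq> r v\<close> by (simp add: algebra_simps)
  ultimately show ?L unfolding rooted_solution_def by blast
qed

section \<open>Contraction of difference systems over the reals and modulo \<open>q\<close>\<close>

definition multiples :: "int \<Rightarrow> int set" where
  "multiples q = {a. q dvd a}"

lemma additive_subgroup_zero: "additive_subgroup {0}"
  and additive_subgroup_multiples: "additive_subgroup (multiples q)"
  unfolding additive_subgroup_def multiples_def by auto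

lemma edge_solution_insert:
  "edge_solution H (insert (u, v, s) E) x \<longleftrightarrow> edge_solution H E x \<and> x u - x v - of_int s \<in> H"
  unfolding edge_solution_def by auto

text \<open>Contracting the edges one by one turns a feasible system into \<open>x i = x (r i) + h i\<close>, where
  \<open>r\<close> picks a root in each connected component; the same \<open>r\<close> and \<open>h\<close> serve over the reals and
  modulo every \<open>q\<close>. An infeasible system has a cycle of nonzero total weight, which stays nonzero
  modulo large \<open>q\<close>.\<close>

lemma edge_solution_normal_form:
  fixes E :: "('n \<times> 'n \<times> int) set"
  assumes "finite E"
  shows "(\<exists>r h. (\<forall>i. r (r i) = r i) \<and> (\<forall>i. r i = i \<longrightarrow> h i = 0)
        \<and> (\<forall>x. edge_solution {0::real} E x \<longleftrightarrow> rooted_solution {0} r h x)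
        \<and> (\<forall>q x. edge_solution (multiples q) E x \<longleftrightarrow> rooted_solution (multiples q) r h x))
    \<or> ((\<forall>x. \<not> edge_solution {0::real} E x) \<and>
        (\<exists>Q. \<forall>q>Q. \<forall>x. \<not> edge_solution (multiples q) E x))"
  using assms
proof (induction E rule: finite_induct)
  case empty
  have "edge_solution {0::real} {} x \<longleftrightarrow> rooted_solution {0} (\<lambda>i. i) (\<lambda>i. 0) x" for x :: "'n \<Rightarrow> real"
    by (simp add: edge_solution_def rooted_solution_def)
  moreover have "edge_solution (multiples q) {} x \<longleftrightarrow> rooted_solution (multiples q) (\<lambda>i. i) (\<lambda>i. 0) x"
    for x :: "'n \<Rightarrow> int" and q
    by (simp add: edge_solution_def rooted_solution_def multiples_def)
  ultimately show ?case
    by (intro disjI1 exI[of _ "\<lambda>i. i"] exI[of _ "\<lambda>i. 0"]) simp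
next
  case (insert e E)
  obtain u v s where e: "e = (u, v, s)" by (cases e)
  from insert.IH show ?case
  proof (elim disjE exE conjE)
    fix r h
    assume idem: "\<forall>i. r (r i) = r i" and root: "\<forall>i. r i = i \<longrightarrow> h i = 0"
      and R: "\<forall>x. edge_solution {0::real} E x \<longleftrightarrow> rooted_solution {0} r h x"
      and M: "\<forall>q x. edge_solution (multiples q) E x \<longleftrightarrow> rooted_solution (multiples q) r h x"
    show ?thesis
    proof (cases "r u = r v")
      case True
      show ?thesis
      proof (cases "h u - h v - s = 0")
        case z: True
        have "edge_solution {0} (insert e E) x \<longleftrightarrow> rooted_solution {0::real} r h x" for x
          unfolding e edge_solution_insert using R
            rooted_solution_same_root[where r = r and u = u and v = v and h = h and x = x and s = s,
              OF additive_subgroup_zero _ True] z by auto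
        moreover have "edge_solution (multiples q) (insert e E) x \<longleftrightarrow> rooted_solution (multiples q) r h x" for q x
          unfolding e edge_solution_insert
          using M
            rooted_solution_same_root[where r = r and u = u and v = v and h = h and x = x and s = s,
              OF additive_subgroup_multiples[of q] _ True] z by (auto simp: multiples_def)
        ultimately show ?thesis using idem root by blast
      next
        case nz: False
        have "\<not> edge_solution {0::real} (insert e E) x" for x
          unfolding e edge_solution_insert using R
            rooted_solution_same_root[where r = r and u = u and v = v and h = h and x = x and s = s,
              OF additive_subgroup_zero _ True] nz
          by (metis of_int_0_eq_iff singletonD)
        moreover have "\<not> edge_solution (multiples q) (insert e E) x" if "q > \<bar>h u - h v - s\<bar>" for q x
          unfolding e edge_solution_insert
          using M
            rooted_solution_same_root[where r = r and u = u and v = v and h = h and x = x and s = s,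
              OF additive_subgroup_multiples[of q] _ True] nz that
            dvd_imp_le_int[of "h u - h v - s" q]
          by (auto simp: multiples_def)
        ultimately show ?thesis by blast
      qed
    next
      case False
      define r' where "r' = (\<lambda>k. if r k = r u then r v else r k)"
      define h' where "h' = (\<lambda>k. if r k = r u then h k + s + h v - h u else h k)"
      have "edge_solution {0} (insert e E) x \<longleftrightarrow> rooted_solution {0::real} r' h' x" for x
        unfolding e edge_solution_insert r'_def h'_def
        using R rooted_solution_merge[OF additive_subgroup_zero, of r h u v x s] idem root False by blast
      moreover have "edge_solution (multiples q) (insert e E) x \<longleftrightarrow> rooted_solution (multiples q) r' h' x" for q x
        unfolding e edge_solution_insert r'_def h'_def
        using M rooted_solution_merge[OF additive_subgroup_multiples, of r h u v q x s] idem root False by blast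
      moreover have "r' (r' i) = r' i" for i
        using idem False by (auto simp: r'_def)
      moreover have "r' i = i \<longrightarrow> h' i = 0" for i
        using idem root False by (auto simp: r'_def h'_def)
      ultimately show ?thesis by blast
    qed
  next
    fix Q
    assume "\<forall>x. \<not> edge_solution {0::real} E x" "\<forall>q>Q. \<forall>x. \<not> edge_solution (multiples q) E x"
    then have "\<forall>x. \<not> edge_solution {0::real} (insert e E) x"
      "\<forall>q>Q. \<forall>x. \<not> edge_solution (multiples q) (insert e E) x"
      unfolding e edge_solution_insert by simp_all
    then show ?thesis by blast
  qed
qed

text \<open>The root coordinates are free parameters: the solution set is a translate, by the offset
  vector, of an injective linear image of the coordinate subspace \<open>W\<close> carried by the
  roots.\<close>

lemma aff_dim_rooted_solutions:
  fixes r :: "'n::finite \<Rightarrow> 'n"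
  assumes idem: "\<And>i. r (r i) = r i" and root: "\<And>i. r i = i \<Longrightarrow> h i = 0"
  shows "aff_dim {x :: real^'n. rooted_solution {0} r h (($) x)} = int (card {i. r i = i})"
proof -
  define F where "F = {i. r i = i}"
  \<comment> \<open>On \<open>W\<close> this copies each root coordinate to its component. At a
    non-root the summand \<open>y $ i\<close> is 0 on \<open>W\<close>; it makes \<open>f\<close>
    injective on the whole space.\<close>
  define f :: "real^'n \<Rightarrow> real^'n" where "f y = (\<chi> i. if r i = i then y $ i else y $ i + y $ r i)" for y
  define W where "W = {y :: real^'n. \<forall>i. i \<notin> F \<longrightarrow> y $ i = 0}"
  define c :: "real^'n" where "c = (\<chi> i. of_int (h i))"
  have lin: "linear f"
    by (rule linearI) (auto simp: f_def vec_eq_iff algebra_simps)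
  have "inj f"
  proof (rule injI)
    fix y z assume "f y = f z"
    then have eq: "f y $ i = f z $ i" for i by simp
    have "y $ r i = z $ r i" for i using eq[of "r i"] idem[of i] by (simp add: f_def)
    then have "y $ i = z $ i" for i using eq[of i] by (cases "r i = i") (simp_all add: f_def)
    then show "y = z" by (simp add: vec_eq_iff)
  qed
  have "{x :: real^'n. rooted_solution {0} r h (($) x)} = (+) c ` f ` W"
  proof (intro equalityI subsetI)
    fix x :: "real^'n" assume "x \<in> {x. rooted_solution {0} r h (($) x)}"
    then have "x $ i - x $ r i - of_int (h i) = 0" for i
      unfolding rooted_solution_def by blast
    then have sol: "x $ i = x $ r i + of_int (h i)" for i
      by (metis diff_diff_eq eq_iff_diff_eq_0)
    define y :: "real^'n" where "y = (\<chi> i. if r i = i then x $ i else 0)"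
    have "y \<in> W" by (auto simp: W_def y_def F_def)
    moreover have "x $ i = (c + f y) $ i" for i
      using sol[of i] root[of i] idem[of i] by (cases "r i = i") (simp_all add: c_def f_def y_def)
    then have "x = c + f y" by (simp add: vec_eq_iff)
    ultimately show "x \<in> (+) c ` f ` W" by blast
  next
    fix x assume "x \<in> (+) c ` f ` W"
    then obtain y where y: "y \<in> W" "x = c + f y" by blast
    have "x $ i - x $ r i - of_int (h i) = 0" for i
      using y idem[of i] root[of i] root[of "r i"]
      by (cases "r i = i") (auto simp: W_def F_def c_def f_def)
    then show "x \<in> {x. rooted_solution {0} r h (($) x)}"
      by (simp add: rooted_solution_def)
  qed
  then have "aff_dim {x :: real^'n. rooted_solution {0} r h (($) x)} = aff_dim W"
    using lin \<open>inj f\<close> by (simp add: aff_dim_translation_eq)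
  also have "\<dots> = int (dim W)"
    by (rule aff_dim_subspace) (auto simp: W_def subspace_def)
  also have "dim W = card F"
    using dim_substandard_cart[of F, where 'a = real] by (simp add: W_def dim_vec_eq)
  finally show ?thesis by (simp add: F_def)
qed

text \<open>The residues at the roots are free, and every other residue follows by adding its offset
  modulo \<open>q\<close>.\<close>

lemma card_rooted_solutions_mod:
  fixes r :: "'n::finite \<Rightarrow> 'n"
  assumes idem: "\<And>i. r (r i) = r i" and root: "\<And>i. r i = i \<Longrightarrow> h i = 0" and "q > 0"
  shows "card {x \<in> UNIV \<rightarrow> {0..<q}. rooted_solution (multiples q) r h x} = nat q ^ card {i. r i = i}"
proof -
  define F where "F = {i. r i = i}"
  have "bij_betw (\<lambda>x. restrict x F) {x \<in> UNIV \<rightarrow> {0..<q}. rooted_solution (multiples q) r h x}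
      (F \<rightarrow>\<^sub>E {0..<q})"
  proof (rule bij_betw_byWitness[where f' = "\<lambda>z i. (z (r i) + h i) mod q"])
    show "\<forall>x\<in>{x \<in> UNIV \<rightarrow> {0..<q}. rooted_solution (multiples q) r h x}.
        (\<lambda>i. (restrict x F (r i) + h i) mod q) = x"
    proof (intro ballI ext)
      fix x i assume x: "x \<in> {x \<in> UNIV \<rightarrow> {0..<q}. rooted_solution (multiples q) r h x}"
      then have "q dvd x i - (x (r i) + h i)"
        by (simp add: rooted_solution_def multiples_def algebra_simps)
      then have "(x (r i) + h i) mod q = x i mod q"
        by (metis mod_eq_dvd_iff)
      moreover have "0 \<le> x i" "x i < q" using x by auto
      ultimately show "(restrict x F (r i) + h i) mod q = x i"
        using idem by (simp add: F_def)
    qed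
    show "\<forall>z\<in>F \<rightarrow>\<^sub>E {0..<q}. restrict (\<lambda>i. (z (r i) + h i) mod q) F = z"
    proof (intro ballI ext)
      fix z i assume z: "z \<in> F \<rightarrow>\<^sub>E {0..<q}"
      show "restrict (\<lambda>i. (z (r i) + h i) mod q) F i = z i"
      proof (cases "i \<in> F")
        case True
        then have "z i \<in> {0..<q}" using z by auto
        then show ?thesis using True root by (simp add: F_def)
      next
        case False
        then show ?thesis using PiE_arb[OF z] by simp
      qed
    qed
    show "(\<lambda>x. restrict x F) ` {x \<in> UNIV \<rightarrow> {0..<q}. rooted_solution (multiples q) r h x}
        \<subseteq> F \<rightarrow>\<^sub>E {0..<q}"
      by (auto simp: Pi_iff)
    show "(\<lambda>z i. (z (r i) + h i) mod q) ` (F \<rightarrow>\<^sub>E {0..<q})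
        \<subseteq> {x \<in> UNIV \<rightarrow> {0..<q}. rooted_solution (multiples q) r h x}"
    proof (intro image_subsetI CollectI conjI)
      fix z assume z: "z \<in> F \<rightarrow>\<^sub>E {0..<q}"
      show "(\<lambda>i. (z (r i) + h i) mod q) \<in> UNIV \<rightarrow> {0..<q}" using \<open>q > 0\<close> by simp
      have "q dvd (z (r i) + h i) mod q - (z (r (r i)) + h (r i)) mod q - h i" for i
      proof -
        have "z (r i) \<in> {0..<q}" using z idem by (auto simp: F_def)
        then have "(z (r (r i)) + h (r i)) mod q = z (r i)"
          using idem root by simp
        moreover have "q dvd (z (r i) + h i) mod q - (z (r i) + h i)"
          by (metis mod_eq_dvd_iff mod_mod_trivial)
        ultimately show ?thesis by (simp add: algebra_simps)
      qed
      then show "rooted_solution (multiples q) r h (\<lambda>i. (z (r i) + h i) mod q)"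
        by (simp add: rooted_solution_def multiples_def)
    qed
  qed
  then have "card {x \<in> UNIV \<rightarrow> {0..<q}. rooted_solution (multiples q) r h x} = card (F \<rightarrow>\<^sub>E {0..<q})"
    by (rule bij_betw_same_card)
  also have "\<dots> = nat q ^ card F"
    by (simp add: card_PiE)
  finally show ?thesis by (simp add: F_def)
qed

section \<open>Counting points modulo \<open>q\<close>\<close>

definition edges :: "int \<Rightarrow> int \<Rightarrow> ('n::linorder \<times> 'n \<times> int) set" where
  "edges c d = {(i, j, s). i < j \<and> c \<le> s \<and> s \<le> d}"

definition edge_hyperplane :: "'n \<times> 'n \<times> int \<Rightarrow> (real^'n) set" where
  "edge_hyperplane e = (case e of (i, j, s) \<Rightarrow> {x. x $ i - x $ j = of_int s})"

text \<open>The residue vectors modulo \<open>q\<close> lying on no hyperplane of the arrangement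
  reduced modulo \<open>q\<close>.\<close>

definition proper_colourings :: "int \<Rightarrow> int \<Rightarrow> int \<Rightarrow> ('n::linorder \<Rightarrow> int) set" where
  "proper_colourings c d q =
     {x \<in> UNIV \<rightarrow> {0..<q}. \<forall>(i, j, s) \<in> edges c d. \<not> q dvd x i - x j - s}"

section \<open>Hyperplanes indexed by edges\<close>

lemma deformation_arrangement_eq_image: "deformation_arrangement c d = edge_hyperplane ` edges c d"
  unfolding deformation_arrangement_def edges_def edge_hyperplane_def by force

lemma finite_edges: "finite (edges c d :: ('n::{finite,linorder} \<times> 'n \<times> int) set)"
  by (rule finite_subset[of _ "UNIV \<times> UNIV \<times> {c..d}"]) (auto simp: edges_def)

text \<open>Subsets of the arrangement thereby correspond to edge sets of the same cardinality. A
  hyperplane is closed under moves in every coordinate outside its pair, which determines the pair;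
  the order of the labels fixes the orientation, and then \<open>s\<close> is determined.\<close>

lemma inj_on_edge_hyperplane:
  "inj_on edge_hyperplane (edges c d :: ('n::{finite,linorder} \<times> 'n \<times> int) set)"
proof (rule inj_onI)
  fix e e' :: "'n \<times> 'n \<times> int"
  assume e: "e \<in> edges c d" and e': "e' \<in> edges c d"
    and eq: "edge_hyperplane e = edge_hyperplane e'"
  obtain i j s where ijs: "e = (i, j, s)" "i < j" using e by (auto simp: edges_def)
  obtain i' j' s' where ijs': "e' = (i', j', s')" "i' < j'" using e' by (auto simp: edges_def)
  define x :: "(real, 'n) vec" where "x = (\<chi> k. if k = i then of_int s else 0)"
  have mem: "z $ i - z $ j = of_int s \<longleftrightarrow> z $ i' - z $ j' = of_int s'" for z :: "(real, 'n) vec"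
    using eq unfolding ijs ijs' edge_hyperplane_def by auto
  have x: "x $ i - x $ j = of_int s" using ijs by (simp add: x_def)
  have "k \<noteq> i' \<and> k \<noteq> j'" if "k \<noteq> i" "k \<noteq> j" for k
  proof -
    \<comment> \<open>Moving \<open>x\<close> in coordinate \<open>k\<close> stays on the common
      hyperplane, so \<open>k\<close> cannot belong to the second pair.\<close>
    define z :: "(real, 'n) vec" where "z = (\<chi> l. x $ l + (if l = k then 1 else 0))"
    have "z $ i - z $ j = of_int s" using x that by (simp add: z_def)
    then have "z $ i' - z $ j' = x $ i' - x $ j'" using mem x by metis
    then show ?thesis using ijs' by (auto simp: z_def split: if_splits)
  qed
  then have "i' = i" "j' = j" using ijs ijs' by (metis order.asym)+
  moreover have "s' = s" using mem[of x] x calculation by simp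
  ultimately show "e = e'" using ijs ijs' by simp
qed

lemma Inter_edge_hyperplanes:
  "\<Inter>(edge_hyperplane ` E) = {x. edge_solution {0} E (($) x)}"
  unfolding edge_hyperplane_def edge_solution_def by (fastforce simp: algebra_simps)

text \<open>In solved form the number of roots is both the dimension of the flat and the exponent of
  \<open>q\<close> in the count. An inconsistent system has no solutions modulo large
  \<open>q\<close> either.\<close>

lemma eventually_card_edge_solutions:
  fixes E :: "('n::finite \<times> 'n \<times> int) set"
  assumes "finite E"
  shows "\<forall>\<^sub>F q in at_top.
    real (card {x \<in> UNIV \<rightarrow> {0..<q}. edge_solution (multiples q) E x}) =
    (if \<Inter>(edge_hyperplane ` E) \<noteq> {} then of_int q ^ nat (aff_dim (\<Inter>(edge_hyperplane ` E))) else 0)"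
  using edge_solution_normal_form[OF assms]
proof (elim disjE exE conjE)
  fix r h
  assume idem: "\<forall>i. r (r i) = r i" and root: "\<forall>i. r i = i \<longrightarrow> h i = 0"
    and R: "\<forall>x. edge_solution {0::real} E x \<longleftrightarrow> rooted_solution {0} r h x"
    and M: "\<forall>q x. edge_solution (multiples q) E x \<longleftrightarrow> rooted_solution (multiples q) r h x"
  have I: "\<Inter>(edge_hyperplane ` E) = {x. rooted_solution {0} r h (($) x)}"
    unfolding Inter_edge_hyperplanes using R by auto
  have dim: "aff_dim (\<Inter>(edge_hyperplane ` E)) = int (card {i. r i = i})"
    unfolding I using idem root by (intro aff_dim_rooted_solutions) auto
  then have ne: "\<Inter>(edge_hyperplane ` E) \<noteq> {}"
    by (metis aff_dim_empty_eq of_nat_0_le_iff not_less_eq_eq neg_0_le_iff_le not_one_le_zero)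
  have "real (card {x \<in> UNIV \<rightarrow> {0..<q}. edge_solution (multiples q) E x}) = of_int q ^ card {i. r i = i}"
    if "q > 0" for q
    using card_rooted_solutions_mod[of r h q] idem root that M by simp
  then show ?thesis
    using eventually_mono[OF eventually_gt_at_top[of "0 :: int"]] ne dim by simp
next
  fix Q
  assume no: "\<forall>x. \<not> edge_solution {0::real} E x" "\<forall>q>Q. \<forall>x. \<not> edge_solution (multiples q) E x"
  then have "\<Inter>(edge_hyperplane ` E) = {}"
    unfolding Inter_edge_hyperplanes by auto
  then show ?thesis
    using eventually_mono[OF eventually_gt_at_top[of Q]] no(2) by simp
qed

text \<open>Inclusion-exclusion: the indicator of avoiding every edge is a product of factors 1
  minus an indicator, expanded over subsets of the edges.\<close>

lemma card_proper_colourings: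
  fixes c d q :: int
  shows "real (card (proper_colourings c d q :: ('n::{finite,linorder} \<Rightarrow> int) set)) =
    (\<Sum>E \<in> Pow (edges c d :: ('n \<times> 'n \<times> int) set).
       (-1) ^ card E * real (card {x \<in> UNIV \<rightarrow> {0..<q}. edge_solution (multiples q) E x}))"
proof -
  define X where "X = ((UNIV :: 'n set) \<rightarrow> {0..<q})"
  define T where "T = (edges c d :: ('n \<times> 'n \<times> int) set)"
  define hit where "hit e x = (case e of (i, j, s) \<Rightarrow> q dvd x i - x j - s)" for e and x :: "'n \<Rightarrow> int"
  have "finite X"
    unfolding X_def using finite_PiE[of UNIV "\<lambda>_ :: 'n. {0..<q}"] by (simp add: PiE_UNIV_domain)
  have "finite T" unfolding T_def by (rule finite_edges)
  have all: "(\<Prod>e\<in>E. of_bool (hit e x) :: real) = of_bool (edge_solution (multiples q) E x)"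
    if "E \<in> Pow T" for E x
  proof -
    have "finite E" using that \<open>finite T\<close> finite_subset by auto
    then have "(\<Prod>e\<in>E. of_bool (hit e x) :: real) = of_bool (\<forall>e\<in>E. hit e x)"
      by (induction E rule: finite_induct) auto
    also have "(\<forall>e\<in>E. hit e x) \<longleftrightarrow> edge_solution (multiples q) E x"
      by (auto simp: hit_def edge_solution_def multiples_def)
    finally show ?thesis .
  qed
  have none: "(\<Prod>e\<in>T. 1 - of_bool (hit e x) :: real) = of_bool (\<forall>e\<in>T. \<not> hit e x)" for x
    using \<open>finite T\<close> by (induction T rule: finite_induct) auto
  have "real (card (proper_colourings c d q :: ('n \<Rightarrow> int) set)) = (\<Sum>x\<in>X. of_bool (\<forall>e\<in>T. \<not> hit e x))"
  proof -
    have "proper_colourings c d q = X \<inter> {x. \<forall>e\<in>T. \<not> hit e x}"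
      unfolding proper_colourings_def X_def T_def hit_def by auto
    then show ?thesis using \<open>finite X\<close> by (simp add: sum_of_bool_eq)
  qed
  also have "\<dots> = (\<Sum>x\<in>X. \<Sum>E\<in>Pow T. (-1) ^ card E * of_bool (edge_solution (multiples q) E x))"
    unfolding none[symmetric] prod_diff_conv_sum[OF \<open>finite T\<close>] using all
    by (intro sum.cong refl) simp
  also have "\<dots> = (\<Sum>E\<in>Pow T. \<Sum>x\<in>X. (-1) ^ card E * of_bool (edge_solution (multiples q) E x))"
    by (rule sum.swap)
  also have "\<dots> = (\<Sum>E\<in>Pow T. (-1) ^ card E * real (card (X \<inter> {x. edge_solution (multiples q) E x})))"
    using \<open>finite X\<close> by (simp add: sum_distrib_left[symmetric] sum_of_bool_eq)
  finally show ?thesis unfolding X_def T_def by (simp add: Int_def)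
qed

text \<open>The finite field method, done term by term in the sum over subarrangements. No primality
  of \<open>q\<close> is required, since the solved form of a difference system has integer offsets
  and unit coefficients.\<close>

lemma characteristic_polynomial_eventually_counts:
  "\<forall>\<^sub>F q in at_top.
     poly (characteristic_polynomial (deformation_arrangement c d :: (real, 'n::{finite,linorder}) vec set set)) (of_int q)
     = real (card (proper_colourings c d q :: ('n \<Rightarrow> int) set))"
proof -
  define T where "T = (edges c d :: ('n \<times> 'n \<times> int) set)"
  let ?A = "deformation_arrangement c d :: (real, 'n) vec set set"
  let ?flat = "\<lambda>E :: ('n \<times> 'n \<times> int) set. \<Inter>(edge_hyperplane ` E)"
  have "finite T" unfolding T_def by (rule finite_edges)
  have "inj_on edge_hyperplane T" unfolding T_def by (rule inj_on_edge_hyperplane)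
  have A: "?A = edge_hyperplane ` T" unfolding T_def by (rule deformation_arrangement_eq_image)
  have "poly (characteristic_polynomial ?A) t =
      (\<Sum>E\<in>Pow T. (-1) ^ card E * (if ?flat E \<noteq> {} then t ^ nat (aff_dim (?flat E)) else 0))" for t
  proof -
    have "finite ?A" using \<open>finite T\<close> A by simp
    then have "poly (characteristic_polynomial ?A) t =
        (\<Sum>B\<in>Pow ?A. (-1) ^ card B * (if \<Inter>B \<noteq> {} then t ^ nat (aff_dim (\<Inter>B)) else 0))"
      unfolding characteristic_polynomial_def poly_sum
      by (intro sum.mono_neutral_cong_left) (auto simp: poly_monom)
    also have "Pow ?A = (`) edge_hyperplane ` Pow T"
      unfolding A by (simp add: image_Pow_surj)
    also have "(\<Sum>B\<in>(`) edge_hyperplane ` Pow T.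
        (-1) ^ card B * (if \<Inter>B \<noteq> {} then t ^ nat (aff_dim (\<Inter>B)) else 0)) =
      (\<Sum>E\<in>Pow T. (-1) ^ card (edge_hyperplane ` E) *
         (if ?flat E \<noteq> {} then t ^ nat (aff_dim (?flat E)) else 0))"
      using inj_on_image_Pow[OF \<open>inj_on edge_hyperplane T\<close>] by (simp add: sum.reindex)
    also have "\<dots> = (\<Sum>E\<in>Pow T. (-1) ^ card E * (if ?flat E \<noteq> {} then t ^ nat (aff_dim (?flat E)) else 0))"
      using card_image[OF inj_on_subset[OF \<open>inj_on edge_hyperplane T\<close>]] by (intro sum.cong refl) simp
    finally show ?thesis .
  qed
  \<comment> \<open>There are finitely many edge sets, so one threshold for \<open>q\<close> serves
    them all.\<close>
  moreover have "\<forall>\<^sub>F q in at_top. \<forall>E\<in>Pow T.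
      real (card {x \<in> UNIV \<rightarrow> {0..<q}. edge_solution (multiples q) E x}) =
      (if ?flat E \<noteq> {} then of_int q ^ nat (aff_dim (?flat E)) else 0)"
    using \<open>finite T\<close> finite_subset
    by (intro eventually_ball_finite ballI eventually_card_edge_solutions) auto
  ultimately show ?thesis
    unfolding card_proper_colourings T_def[symmetric] by (auto elim!: eventually_mono)
qed

section \<open>Placements on a cycle and boxes\<close>

text \<open>Proper placements with the least label at cell 0, written without congruences: the bound
  \<open>q - b\<close> keeps the last \<open>b\<close> cells before the base point empty, so no
  constraint wraps around the cycle.\<close>

definition based_colourings :: "int \<Rightarrow> int \<Rightarrow> ('n::{finite,linorder} \<Rightarrow> int) set" where
  "based_colourings b q = {x. x (Min UNIV) = 0 \<and> (\<forall>i. 0 \<le> x i \<and> x i < q - b) \<and>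
     (\<forall>i j. x j \<le> x i \<and> x i \<le> x j + b \<longrightarrow> j \<le> i)}"

lemma based_colourings_eq:
  assumes "0 \<le> b" "b < q"
  shows "based_colourings b q = {x \<in> proper_colourings 0 b q. x (Min UNIV :: 'n::{finite,linorder}) = 0}"
proof (intro equalityI subsetI)
  fix x :: "'n \<Rightarrow> int" assume x: "x \<in> based_colourings b q"
  have range: "0 \<le> x i" "x i < q - b" for i using x by (auto simp: based_colourings_def)
  have "\<not> q dvd x i - x j - s" if "i < j" "0 \<le> s" "s \<le> b" for i j s
  proof
    assume dvd: "q dvd x i - x j - s"
    \<comment> \<open>The margin \<open>b\<close> in the range of \<open>x\<close> absorbs
      \<open>s\<close>, so divisibility by \<open>q\<close> forces the expression to be 0.\<close>
    have "\<bar>x i - x j - s\<bar> < q" using range[of i] range[of j] that by linarith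
    then have "x i - x j - s = 0" using dvd dvd_imp_le_int[of "x i - x j - s" q] by fastforce
    then have "j \<le> i" using x that by (simp add: based_colourings_def)
    then show False using that by simp
  qed
  moreover have "x i < q" for i using range[of i] assms by linarith
  ultimately show "x \<in> {x \<in> proper_colourings 0 b q. x (Min UNIV) = 0}"
    using x range by (auto simp: proper_colourings_def edges_def based_colourings_def)
next
  fix x :: "'n \<Rightarrow> int" assume x: "x \<in> {x \<in> proper_colourings 0 b q. x (Min UNIV) = 0}"
  then have m: "x (Min UNIV) = 0" and range: "0 \<le> x i" "x i < q" for i
    by (auto simp: proper_colourings_def Pi_iff)
  have nd: "\<not> q dvd x i - x j - s" if "i < j" "0 \<le> s" "s \<le> b" for i j s
    using x that by (auto simp: proper_colourings_def edges_def)
  have "x i < q - b" for i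
  proof (cases "i = Min UNIV")
    case True
    then show ?thesis using m assms by simp
  next
    case False
    then have "Min UNIV < i" by (simp add: order.not_eq_order_implies_strict)
    show ?thesis
    proof (rule ccontr)
      assume "\<not> x i < q - b"
      \<comment> \<open>A label in the last \<open>b\<close> cells is at distance
        \<open>q - x i\<close>, at most \<open>b\<close>, before the least label, which sits at
        0.\<close>
      then have "\<not> q dvd x (Min UNIV) - x i - (q - x i)"
        using range[of i] by (intro nd[OF \<open>Min UNIV < i\<close>]) auto
      then show False using m by simp
    qed
  qed
  moreover have "j \<le> i" if "x j \<le> x i" "x i \<le> x j + b" for i j
  proof (rule ccontr)
    assume "\<not> j \<le> i"
    then have "\<not> q dvd x i - x j - (x i - x j)" using that by (intro nd) auto
    then show False by simp
  qed
  ultimately show "x \<in> based_colourings b q" using m range by (auto simp: based_colourings_def)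
qed

lemma proper_colourings_rotate:
  assumes "x \<in> proper_colourings c d q" "q > 0"
  shows "(\<lambda>i. (x i + t) mod q) \<in> proper_colourings c d q"
proof -
  have "q dvd (x i + t) mod q - (x j + t) mod q - s \<longleftrightarrow> q dvd x i - x j - s" for i j s
  proof -
    have "((x i + t) mod q - (x j + t) mod q - s) mod q = ((x i + t) - (x j + t) - s) mod q"
      by (metis mod_diff_cong mod_diff_eq mod_mod_trivial)
    then show ?thesis by (simp add: dvd_eq_mod_eq_0)
  qed
  then show ?thesis using assms by (auto simp: proper_colourings_def)
qed

text \<open>A placement amounts to the cell of the least label together with its rotation taking
  that label to 0. This is the source of the factor \<open>t\<close> in the polynomial.\<close>

lemma card_proper_colourings_based:
  assumes "0 \<le> b" "b < q"
  shows "card (proper_colourings 0 b q :: ('n::{finite,linorder} \<Rightarrow> int) set)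
    = nat q * card (based_colourings b q :: ('n \<Rightarrow> int) set)"
proof -
  define m where "m = Min (UNIV :: 'n set)"
  let ?P = "proper_colourings 0 b q :: ('n \<Rightarrow> int) set"
  let ?B = "based_colourings b q :: ('n \<Rightarrow> int) set"
  have base: "?B = {x \<in> ?P. x m = 0}" unfolding m_def by (rule based_colourings_eq[OF assms])
  have q: "q > 0" using assms by simp
  have range: "0 \<le> x i" "x i < q" if "x \<in> ?P" for x i
    using that by (auto simp: proper_colourings_def Pi_iff)
  have rotate: "(\<lambda>i. (x i + t) mod q) \<in> ?P" if "x \<in> ?P" for x t
    using proper_colourings_rotate[OF that q] .
  have "bij_betw (\<lambda>x. (x m, \<lambda>i. (x i + - x m) mod q)) ?P ({0..<q} \<times> ?B)"
  proof (rule bij_betw_byWitness[where f' = "\<lambda>(t, x) i. (x i + t) mod q"])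
    show "\<forall>x\<in>?P. (case (x m, \<lambda>i. (x i + - x m) mod q) of (t, x) \<Rightarrow> \<lambda>i. (x i + t) mod q) = x"
      using range by (auto simp: mod_simps)
    show "\<forall>p\<in>{0..<q} \<times> ?B. ((case p of (t, x) \<Rightarrow> \<lambda>i. (x i + t) mod q) m,
        \<lambda>i. ((case p of (t, x) \<Rightarrow> \<lambda>i. (x i + t) mod q) i + - (case p of (t, x) \<Rightarrow> \<lambda>i. (x i + t) mod q) m) mod q) = p"
      using range unfolding base by (auto simp: mod_simps)
    show "(\<lambda>x. (x m, \<lambda>i. (x i + - x m) mod q)) ` ?P \<subseteq> {0..<q} \<times> ?B"
      unfolding base using range rotate by (intro image_subsetI) (simp del: add_uminus_conv_diff)
    show "(\<lambda>(t, x) i. (x i + t) mod q) ` ({0..<q} \<times> ?B) \<subseteq> ?P"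
      unfolding base using rotate by (intro image_subsetI) (simp add: case_prod_beta mem_Times_iff)
  qed
  then have "card ?P = card ({0..<q} \<times> ?B)" by (rule bij_betw_same_card)
  then show ?thesis by (simp add: card_cartesian_product)
qed

text \<open>Label \<open>i\<close> lies in box \<open>\<phi> i\<close>; inside a box the labels increase. A label is followed by a
  stretch of \<open>y i\<close> cells and each box is closed by \<open>b\<close> further empty cells.\<close>

definition box_less :: "('n::linorder \<Rightarrow> int) \<Rightarrow> 'n \<Rightarrow> 'n \<Rightarrow> bool" where
  "box_less \<phi> k i \<longleftrightarrow> \<phi> k < \<phi> i \<or> \<phi> k = \<phi> i \<and> k < i"

definition box_position :: "int \<Rightarrow> ('n::linorder \<Rightarrow> int) \<Rightarrow> ('n \<Rightarrow> int) \<Rightarrow> 'n \<Rightarrow> int" where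
  "box_position b y \<phi> i = b * \<phi> i + (\<Sum>k | box_less \<phi> k i. y k)"

text \<open>The \<open>q\<close> cells consist of the stretches, of total length
  \<open>sum y UNIV\<close>, and \<open>b\<close> closing cells per box, which fixes the number of
  boxes. Putting the least label in box 0 makes it first, at cell 0.\<close>

definition box_configurations :: "int \<Rightarrow> int \<Rightarrow> (('n::{finite,linorder} \<Rightarrow> int) \<times> ('n \<Rightarrow> int)) set" where
  "box_configurations b q = {(y, \<phi>). y \<in> UNIV \<rightarrow> {1..b} \<and> b dvd q - sum y UNIV \<and>
     \<phi> (Min UNIV) = 0 \<and> (\<forall>i. 0 \<le> \<phi> i \<and> \<phi> i < (q - sum y UNIV) div b)}"

text \<open>The inserted \<open>q\<close> represents the return to the label at cell 0, so the gap
  after the last label closes the cycle.\<close>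

definition next_position :: "int \<Rightarrow> ('n \<Rightarrow> int) \<Rightarrow> 'n \<Rightarrow> int" where
  "next_position q x i = Min (insert q (x ` {k. x i < x k}))"

lemma next_position_le:
  fixes x :: "'n::finite \<Rightarrow> int"
  shows "next_position q x i \<le> q" and "x i < x k \<Longrightarrow> next_position q x i \<le> x k"
  unfolding next_position_def by (auto intro!: Min_le)

lemma next_position_cases:
  fixes x :: "'n::finite \<Rightarrow> int"
  obtains (last) "next_position q x i = q" "\<And>k. x k < q \<Longrightarrow> x k \<le> x i"
    | (label) k where "next_position q x i = x k" "x i < x k"
proof (cases "next_position q x i = q")
  case True
  then have "x k \<le> x i" if "x k < q" for k
    using next_position_le(2)[of x i k q] that by linarith
  then show ?thesis using last True by blast
next
  case False
  have "next_position q x i \<in> insert q (x ` {k. x i < x k})"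
    unfolding next_position_def by (rule Min_in) auto
  then show ?thesis using False label by blast
qed

lemma next_position_gt:
  fixes x :: "'n::finite \<Rightarrow> int"
  assumes "x i < q"
  shows "x i < next_position q x i"
  using assms by (cases rule: next_position_cases[of q x i]) auto

text \<open>The gaps telescope. For the induction, the label at the largest position below
  \<open>a\<close> has \<open>a\<close> as its next position, and removing it leaves the same claim
  for its own position.\<close>

lemma sum_gaps:
  fixes x :: "'n::finite \<Rightarrow> int"
  assumes "inj x" and nonneg: "\<And>i. 0 \<le> x i" and bound: "\<And>i. x i < q" and zero: "x m = 0"
    and "a = q \<or> a \<in> range x"
  shows "(\<Sum>k | x k < a. next_position q x k - x k) = a"
  using assms(5)
proof (induction "nat a" arbitrary: a rule: less_induct)
  case less
  have "0 \<le> q" using bound[of m] zero by simp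
  then have "a \<le> q" "0 \<le> a" using less.prems bound nonneg by (auto intro: less_imp_le)
  show ?case
  proof (cases "{k. x k < a} = {}")
    case True
    then have "\<not> x m < a" by blast
    then show ?thesis using True zero \<open>0 \<le> a\<close> by simp
  next
    case False
    define c where "c = Max (x ` {k. x k < a})"
    have "c \<in> x ` {k. x k < a}" unfolding c_def using False by (intro Max_in) auto
    then obtain p where p: "x p = c" "x p < a" by auto
    have max: "x k \<le> x p" if "x k < a" for k
      unfolding p c_def using that by (intro Max_ge) auto
    have "next_position q x p = a"
    proof (rule antisym)
      show "next_position q x p \<le> a" using less.prems next_position_le(1)[of q x p] next_position_le(2)[of x p _ q] p by auto
      show "a \<le> next_position q x p"
        using max \<open>a \<le> q\<close> by (cases rule: next_position_cases[of q x p]) (auto simp: not_less[symmetric])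
    qed
    moreover have "{k. x k < a} = insert p {k. x k < x p}"
      using max p \<open>inj x\<close> by (force simp: le_less inj_eq)
    moreover have "(\<Sum>k | x k < x p. next_position q x k - x k) = x p"
      using p nonneg[of p] by (intro less.hyps) auto
    ultimately show ?thesis by simp
  qed
qed

lemma box_less_irrefl: "\<not> box_less \<phi> i i"
  and box_less_trans: "box_less \<phi> i j \<Longrightarrow> box_less \<phi> j k \<Longrightarrow> box_less \<phi> i k"
  and box_less_total: "i \<noteq> j \<Longrightarrow> box_less \<phi> i j \<or> box_less \<phi> j i"
  by (auto simp: box_less_def)

section \<open>Placements obtained from box configurations\<close>

context
  fixes b q :: int and y \<phi> :: "'n::{finite,linorder} \<Rightarrow> int" and J :: int
  assumes config: "(y, \<phi>) \<in> box_configurations b q" and b: "b > 0"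
  defines "J \<equiv> (q - sum y UNIV) div b"
begin

lemma box_configuration_facts:
  shows "1 \<le> y i" "y i \<le> b" "0 \<le> \<phi> i" "\<phi> i < J" "\<phi> (Min UNIV) = 0" "q = sum y UNIV + b * J"
  using config b unfolding box_configurations_def J_def by (auto simp: Pi_iff)

text \<open>Between the two labels lie at least the stretch of \<open>i\<close> and the closing
  cells of the boxes from \<open>\<phi> i\<close> up to \<open>\<phi> k - 1\<close>.\<close>

lemma box_position_less:
  assumes "box_less \<phi> i k"
  shows "box_position b y \<phi> i + b * (\<phi> k - \<phi> i) + y i \<le> box_position b y \<phi> k"
proof -
  have "insert i {l. box_less \<phi> l i} \<subseteq> {l. box_less \<phi> l k}"
    using assms box_less_trans by auto
  then have "sum y (insert i {l. box_less \<phi> l i}) \<le> sum y {l. box_less \<phi> l k}"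
    using box_configuration_facts(1) by (intro sum_mono2) (auto intro: order_trans[of 0 1])
  then show ?thesis
    by (simp add: box_position_def box_less_irrefl algebra_simps)
qed

lemma box_position_less_iff: "box_position b y \<phi> i < box_position b y \<phi> k \<longleftrightarrow> box_less \<phi> i k"
proof -
  have lt: "box_position b y \<phi> i < box_position b y \<phi> k" if "box_less \<phi> i k" for i k
  proof -
    have "\<phi> i \<le> \<phi> k" using that by (auto simp: box_less_def)
    then have "0 \<le> b * (\<phi> k - \<phi> i)" using b by simp
    then show ?thesis using box_position_less[OF that] box_configuration_facts(1)[of i] by linarith
  qed
  then show ?thesis by (metis box_less_total order.asym order.irrefl)
qed

text \<open>From \<open>i\<close> to the end of the cycle there remain at least its stretch and the
  closing cells of \<open>J - \<phi> i\<close> boxes, its own included.\<close>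

lemma box_position_end:
  "box_position b y \<phi> i + y i + b * (J - \<phi> i) \<le> q"
proof -
  have "sum y (insert i {l. box_less \<phi> l i}) \<le> sum y UNIV"
    using box_configuration_facts(1) by (intro sum_mono2) (auto intro: order_trans[of 0 1])
  then show ?thesis
    using box_configuration_facts(6) by (simp add: box_position_def box_less_irrefl algebra_simps)
qed

lemma box_position_based: "box_position b y \<phi> \<in> based_colourings b q"
proof -
  let ?x = "box_position b y \<phi>"
  have "\<not> box_less \<phi> k (Min UNIV)" for k
    using box_configuration_facts(3)[of k] box_configuration_facts(5) Min_le[of UNIV k]
    by (auto simp: box_less_def)
  then have "?x (Min UNIV) = 0"
    using box_configuration_facts(5) by (simp add: box_position_def)
  moreover have "0 \<le> ?x i" for i
    using box_configuration_facts(1,3) b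
    by (auto simp: box_position_def intro!: add_nonneg_nonneg sum_nonneg intro: order_trans[of 0 1])
  moreover have "?x i < q - b" for i
  proof -
    have "b * 1 \<le> b * (J - \<phi> i)" using b box_configuration_facts(4)[of i] by (intro mult_left_mono) auto
    then show ?thesis using box_position_end[of i] box_configuration_facts(1)[of i] by linarith
  qed
  moreover have "j \<le> i" if le: "?x j \<le> ?x i" "?x i \<le> ?x j + b" for i j
  proof (cases "i = j")
    case False
    have "box_less \<phi> j i"
      using le False box_less_total[of i j \<phi>] box_position_less_iff[of i j] by auto
    \<comment> \<open>Passing to a later box costs \<open>b\<close> closing cells and the nonempty
      stretch of \<open>j\<close>, hence more than \<open>b\<close>; labels at distance at most
      \<open>b\<close> share a box, where they increase.\<close>
    moreover have "\<not> \<phi> j < \<phi> i"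
    proof
      assume "\<phi> j < \<phi> i"
      then have "b * 1 \<le> b * (\<phi> i - \<phi> j)" using b by (intro mult_left_mono) auto
      then show False
        using box_position_less[OF \<open>box_less \<phi> j i\<close>] le box_configuration_facts(1)[of j] by linarith
    qed
    ultimately show ?thesis by (auto simp: box_less_def)
  qed simp
  ultimately show ?thesis by (auto simp: based_colourings_def)
qed

text \<open>The gap after \<open>i\<close> is \<open>y i\<close> plus \<open>b\<close> times the
  number of boxes closed in it. The shift by 1 selects the representative in \<open>{1..b}\<close>,
  so \<open>y\<close> can be read off the positions.\<close>

lemma box_position_gap:
  "y i = (next_position q (box_position b y \<phi>) i - box_position b y \<phi> i - 1) mod b + 1"
proof -
  let ?x = "box_position b y \<phi>"
  have "\<exists>t. next_position q ?x i - ?x i = y i + b * t"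
  proof (cases rule: next_position_cases[of q ?x i])
    case last
    have "?x k \<le> ?x i" for k
      using last(2) box_position_based b by (simp add: based_colourings_def) (smt (verit))
    then have "insert i {l. box_less \<phi> l i} = UNIV"
      using box_less_total box_position_less_iff by (auto simp: not_less[symmetric])
    then have "sum y UNIV = y i + sum y {l. box_less \<phi> l i}"
      by (metis box_less_irrefl finite mem_Collect_eq sum.insert)
    then have "next_position q ?x i - ?x i = y i + b * (J - \<phi> i)"
      using last(1) box_configuration_facts(6) by (simp add: box_position_def algebra_simps)
    then show ?thesis by blast
  next
    case (label k)
    have "box_less \<phi> l k \<longleftrightarrow> l = i \<or> box_less \<phi> l i" for l
    proof
      assume "box_less \<phi> l k"
      then have "\<not> ?x i < ?x l"
        using label next_position_le(2)[of ?x i l q] box_position_less_iff[of l k] by auto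
      then show "l = i \<or> box_less \<phi> l i"
        using box_position_less_iff box_less_total by blast
    next
      assume "l = i \<or> box_less \<phi> l i"
      then show "box_less \<phi> l k" using label(2) box_position_less_iff box_less_trans by blast
    qed
    then have "{l. box_less \<phi> l k} = insert i {l. box_less \<phi> l i}" by auto
    then have "next_position q ?x i - ?x i = y i + b * (\<phi> k - \<phi> i)"
      using label(1) by (simp add: box_position_def box_less_irrefl algebra_simps)
    then show ?thesis by blast
  qed
  then obtain t where t: "next_position q ?x i - ?x i = y i + b * t" by blast
  have "(y i + b * t - 1) mod b = (y i - 1) mod b"
    by (metis add_diff_eq add.commute mod_mult_self2)
  also have "\<dots> = y i - 1"
    using box_configuration_facts(1,2)[of i] by (intro mod_pos_pos_trivial) auto
  finally show ?thesis using t by simp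
qed

end

text \<open>The gaps determine \<open>y\<close>, and the order of the positions determines
  \<open>box_less\<close>; subtracting the stretches from a position then leaves
  \<open>b * \<phi> i\<close>.\<close>

lemma inj_on_box_position:
  assumes "b > 0"
  shows "inj_on (\<lambda>(y, \<phi>). box_position b y \<phi>)
    (box_configurations b q :: (('n::{finite,linorder} \<Rightarrow> int) \<times> ('n \<Rightarrow> int)) set)"
proof (rule inj_onI, clarify)
  fix y \<phi> y' \<phi>' :: "'n \<Rightarrow> int"
  assume c: "(y, \<phi>) \<in> box_configurations b q" and c': "(y', \<phi>') \<in> box_configurations b q"
    and eq: "box_position b y \<phi> = box_position b y' \<phi>'"
  have "y i = y' i" for i
    unfolding box_position_gap[OF c assms, of i] box_position_gap[OF c' assms, of i] eq ..
  then have y: "y = y'" by blast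
  have "\<phi> i = \<phi>' i" for i
  proof -
    have "box_less \<phi> k i \<longleftrightarrow> box_less \<phi>' k i" for k
      using box_position_less_iff[OF c assms] box_position_less_iff[OF c' assms] eq by metis
    then have "b * \<phi> i = b * \<phi>' i"
      using fun_cong[OF eq, of i] by (simp add: box_position_def y)
    then show ?thesis using assms by simp
  qed
  then show "y = y' \<and> \<phi> = \<phi>'" using y by blast
qed

text \<open>Division with remainder in \<open>{1..b}\<close> splits each gap into a stretch
  \<open>y i\<close> and \<open>\<sigma> i\<close> separators; the box of a label is the number of
  separators before it. The main point is that labels with no separator between them
  increase.\<close>

lemma box_position_surj:
  fixes x :: "'n::{finite,linorder} \<Rightarrow> int"
  assumes "b > 0" "q > b" and x: "x \<in> based_colourings b q"
  obtains y \<phi> where "(y, \<phi>) \<in> box_configurations b q" "box_position b y \<phi> = x"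
proof -
  have range: "0 \<le> x i" "x i < q - b" and zero: "x (Min UNIV) = 0" for i
    using x by (auto simp: based_colourings_def)
  have asc: "j \<le> i" if "x j \<le> x i" "x i \<le> x j + b" for i j
    using x that by (auto simp: based_colourings_def)
  have lt: "x i < q" for i using range(2)[of i] assms by linarith
  have "inj x"
  proof (rule injI)
    fix i j assume "x i = x j"
    then show "i = j" using asc[of i j] asc[of j i] assms by simp
  qed
  define g where "g i = next_position q x i - x i" for i
  define \<sigma> where "\<sigma> i = (g i - 1) div b" for i
  define y where "y i = (g i - 1) mod b + 1" for i
  define \<phi> where "\<phi> i = (\<Sum>k | x k < x i. \<sigma> k)" for i
  have g: "1 \<le> g i" for i using next_position_gt[of x i q, OF lt] by (simp add: g_def)
  have gy: "g i = y i + b * \<sigma> i" for i unfolding y_def \<sigma>_def by simp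
  have \<sigma>: "0 \<le> \<sigma> i" for i unfolding \<sigma>_def using g[of i] assms by (simp add: pos_imp_zdiv_nonneg_iff)
  have y: "1 \<le> y i" "y i \<le> b" for i
    unfolding y_def using pos_mod_sign[OF \<open>b > 0\<close>, of "g i - 1"] pos_mod_bound[OF \<open>b > 0\<close>, of "g i - 1"]
    by linarith+
  have gaps: "(\<Sum>k | x k < a. g k) = a" if "a = q \<or> a \<in> range x" for a
    unfolding g_def using sum_gaps[OF \<open>inj x\<close> range(1) lt zero that] .
  have "(\<Sum>k\<in>UNIV. g k) = q" using gaps[of q] lt by simp
  then have q: "q - sum y UNIV = b * sum \<sigma> UNIV"
    by (simp add: gy sum.distrib sum_distrib_left algebra_simps)
  have pos: "x i = b * \<phi> i + (\<Sum>k | x k < x i. y k)" for i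
    using gaps[of "x i"] by (simp add: gy sum.distrib sum_distrib_left \<phi>_def algebra_simps)
  have less: "box_less \<phi> k i" if "x k < x i" for k i
  proof -
    have split: "\<phi> i = \<phi> k + (\<Sum>l | x k \<le> x l \<and> x l < x i. \<sigma> l)"
    proof -
      have "{l. x l < x i} = {l. x l < x k} \<union> {l. x k \<le> x l \<and> x l < x i}" using that by auto
      then show ?thesis unfolding \<phi>_def by (simp add: sum.union_disjoint[symmetric] disjoint_iff)
    qed
    show ?thesis
    proof (cases "\<phi> k < \<phi> i")
      case False
      then have z: "(\<Sum>l | x k \<le> x l \<and> x l < x i. \<sigma> l) = 0"
        using split \<sigma> sum_nonneg[of "{l. x k \<le> x l \<and> x l < x i}" \<sigma>] by force
      then have \<sigma>0: "\<sigma> l = 0" if "x k \<le> x l" "x l < x i" for l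
        using that \<sigma> by (subst (asm) sum_nonneg_eq_0_iff) auto
      have "k < i"
      proof (rule ccontr)
        assume "\<not> k < i"
        then have "i < k" using that by (metis linorder_neqE order.irrefl)
        \<comment> \<open>Take the last label \<open>l\<close> before \<open>i\<close>, from
          \<open>k\<close> on, that exceeds \<open>i\<close>. No separator follows it, so its gap is
          at most \<open>b\<close> and its successor is at least \<open>l\<close>. That successor is
          then not \<open>i\<close>, lies before \<open>i\<close> and is again in \<open>S\<close>,
          against the choice of \<open>l\<close>.\<close>
        define S where "S = {l. i < l \<and> x k \<le> x l \<and> x l < x i}"
        have "x ` S \<noteq> {}" using \<open>i < k\<close> that by (auto simp: S_def)
        then have "Max (x ` S) \<in> x ` S" by (intro Max_in) auto
        then obtain l where l: "l \<in> S" "x l = Max (x ` S)" by auto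
        have max: "x l' \<le> x l" if "l' \<in> S" for l' unfolding l using that by (intro Max_ge) auto
        have "g l \<le> b" using gy[of l] \<sigma>0[of l] y(2)[of l] l by (simp add: S_def)
        have "next_position q x l \<le> x i" using l by (intro next_position_le) (simp add: S_def)
        then obtain l' where l': "next_position q x l = x l'" "x l < x l'"
          using lt[of i] by (cases rule: next_position_cases[of q x l]) auto
        have "l \<le> l'" using l' \<open>g l \<le> b\<close> by (intro asc) (auto simp: g_def)
        then have "i < l'" using l by (auto simp: S_def)
        moreover have "x l' < x i"
          using \<open>next_position q x l \<le> x i\<close> l' \<open>inj x\<close> \<open>i < l'\<close> by (metis injD order.irrefl order_le_imp_less_or_eq)
        ultimately have "l' \<in> S" using l l' by (auto simp: S_def)
        then show False using max l' by fastforce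
      qed
      moreover have "\<phi> k = \<phi> i" using split z by simp
      ultimately show ?thesis by (simp add: box_less_def)
    qed (simp add: box_less_def)
  qed
  have less_iff: "box_less \<phi> k i \<longleftrightarrow> x k < x i" for k i
    using less \<open>inj x\<close> by (metis box_less_irrefl box_less_trans injD linorder_neqE)
  have "box_position b y \<phi> = x"
    using pos by (intro ext) (simp add: box_position_def less_iff)
  moreover have "\<phi> i < sum \<sigma> UNIV" for i
  proof -
    have "Max (range x) \<in> range x" by (intro Max_in) auto
    then obtain t where t: "x t = Max (range x)" by (metis imageE)
    then have max: "x k \<le> x t" for k by simp
    have "next_position q x t = q"
      using max by (cases rule: next_position_cases[of q x t]) (auto simp: not_le[symmetric])
    \<comment> \<open>The strict bound \<open>x t < q - b\<close> makes the last gap at least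
      \<open>b + 1\<close>, so a separator follows the last label and every box number stays below
      the total.\<close>
    then have "b \<le> g t - 1" using range(2)[of t] by (simp add: g_def)
    then have "0 < \<sigma> t" using assms by (simp add: \<sigma>_def pos_imp_zdiv_pos_iff)
    have "\<phi> i + \<sigma> t = sum \<sigma> (insert t {k. x k < x i})"
      using max[of i] by (simp add: \<phi>_def)
    also have "\<dots> \<le> sum \<sigma> UNIV" using \<sigma> by (intro sum_mono2) auto
    finally show ?thesis using \<open>0 < \<sigma> t\<close> by simp
  qed
  moreover have "\<phi> (Min UNIV) = 0"
    using range(1) zero by (simp add: \<phi>_def not_less[symmetric] del: not_less)
  moreover have "0 \<le> \<phi> i" for i using \<sigma> by (simp add: \<phi>_def sum_nonneg)
  ultimately show ?thesis
    using that[of y \<phi>] y q assms by (auto simp: box_configurations_def Pi_iff)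
qed

text \<open>For fixed \<open>y\<close> the least label is in box 0 and each other label chooses its
  box freely. The lower bound on \<open>q\<close> makes the number of boxes positive for every
  \<open>y\<close>, so the conversion through \<open>nat\<close> loses nothing.\<close>

lemma card_based_colourings:
  assumes "b > 0" "q > int CARD('n) * b"
  shows "int (card (based_colourings b q :: ('n::{finite,linorder} \<Rightarrow> int) set)) =
    (\<Sum>y \<in> {y \<in> (UNIV :: 'n set) \<rightarrow> {1..b}. b dvd q - sum y UNIV}.
       ((q - sum y UNIV) div b) ^ (CARD('n) - 1))"
proof -
  define Y where "Y = {y \<in> (UNIV :: 'n set) \<rightarrow> {1..b}. b dvd q - sum y UNIV}"
  define F where "F J = {\<phi> :: 'n \<Rightarrow> int. \<phi> (Min UNIV) = 0 \<and> (\<forall>i. 0 \<le> \<phi> i \<and> \<phi> i < J)}" for J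
  have "finite Y"
    unfolding Y_def using finite_PiE[of UNIV "\<lambda>_ :: 'n. {1..b}"] by (simp add: PiE_UNIV_domain)
  have "0 < CARD('n)" by simp
  then have "1 \<le> int CARD('n)" by linarith
  then have "b * 1 \<le> b * int CARD('n)" using assms by (intro mult_left_mono) auto
  then have "q > b" using assms by (simp only: mult.commute[of b] mult_1_left)
  have F: "card (F J) = nat J ^ (CARD('n) - 1)" "finite (F J)" if "J > 0" for J
  proof -
    have F: "F J = (\<Pi>\<^sub>E i\<in>UNIV. if i = Min UNIV then {0} else {0..<J})"
    proof (intro equalityI subsetI)
      fix \<phi> :: "'n \<Rightarrow> int" assume "\<phi> \<in> (\<Pi>\<^sub>E i\<in>UNIV. if i = Min UNIV then {0} else {0..<J})"
      then have "\<phi> i \<in> (if i = Min UNIV then {0} else {0..<J})" for i by blast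
      then have "0 \<le> \<phi> i \<and> \<phi> i < J \<and> (i = Min UNIV \<longrightarrow> \<phi> i = 0)" for i
        using that by (smt (verit) atLeastLessThan_iff singletonD)
      then show "\<phi> \<in> F J" by (simp add: F_def)
    qed (auto simp: F_def PiE_UNIV_domain)
    show "finite (F J)" unfolding F by (rule finite_PiE) auto
    have "card (F J) = (\<Prod>i\<in>UNIV. if i = (Min UNIV :: 'n) then 1 else nat J)"
      unfolding F by (subst card_PiE) (auto intro!: prod.cong)
    also have "\<dots> = (\<Prod>i\<in>UNIV - {Min UNIV :: 'n}. nat J)"
      by (subst prod.remove[of _ "Min UNIV"]) (auto intro!: prod.cong)
    finally show "card (F J) = nat J ^ (CARD('n) - 1)" by simp
  qed
  have J: "(q - sum y UNIV) div b > 0" if "y \<in> Y" for y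
  proof -
    have "sum y UNIV \<le> (\<Sum>i\<in>(UNIV :: 'n set). b)"
      using that by (intro sum_mono) (auto simp: Y_def Pi_iff)
    then have "0 < q - sum y UNIV" using assms by simp
    moreover have "b dvd q - sum y UNIV" using that by (simp add: Y_def)
    ultimately show ?thesis using assms by (metis pos_imp_zdiv_pos_iff zdvd_imp_le)
  qed
  have "bij_betw (\<lambda>(y, \<phi>). box_position b y \<phi>) (box_configurations b q)
      (based_colourings b q :: ('n \<Rightarrow> int) set)"
    unfolding bij_betw_def
  proof (intro conjI equalityI subsetI)
    show "inj_on (\<lambda>(y, \<phi>). box_position b y \<phi>)
        (box_configurations b q :: (('n \<Rightarrow> int) \<times> ('n \<Rightarrow> int)) set)"
      using inj_on_box_position assms by blast
    fix x :: "'n \<Rightarrow> int"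
    show "x \<in> based_colourings b q" if "x \<in> (\<lambda>(y, \<phi>). box_position b y \<phi>) ` box_configurations b q"
      using that box_position_based assms by auto
    show "x \<in> (\<lambda>(y, \<phi>). box_position b y \<phi>) ` box_configurations b q" if "x \<in> based_colourings b q"
    proof -
      obtain y \<phi> where "(y, \<phi>) \<in> box_configurations b q" "box_position b y \<phi> = x"
        using box_position_surj[OF assms(1) \<open>q > b\<close> \<open>x \<in> _\<close>] .
      then show ?thesis by (metis (mono_tags, lifting) case_prod_conv image_eqI)
    qed
  qed
  then have "card (based_colourings b q :: ('n \<Rightarrow> int) set)
      = card (box_configurations b q :: (('n \<Rightarrow> int) \<times> ('n \<Rightarrow> int)) set)"
    by (rule bij_betw_same_card[symmetric])
  also have "box_configurations b q = (SIGMA y:Y. F ((q - sum y UNIV) div b))"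
    by (auto simp: box_configurations_def Y_def F_def)
  also have "card \<dots> = (\<Sum>y\<in>Y. card (F ((q - sum y UNIV) div b)))"
    using \<open>finite Y\<close> F J by (intro card_SigmaI) auto
  also have "\<dots> = (\<Sum>y\<in>Y. nat ((q - sum y UNIV) div b) ^ (CARD('n) - 1))"
    using F J by (intro sum.cong) auto
  finally have "int (card (based_colourings b q :: ('n \<Rightarrow> int) set)) =
      (\<Sum>y\<in>Y. int (nat ((q - sum y UNIV) div b)) ^ (CARD('n) - 1))" by simp
  also have "\<dots> = (\<Sum>y\<in>Y. ((q - sum y UNIV) div b) ^ (CARD('n) - 1))"
    using J by (intro sum.cong refl) (simp add: less_imp_le)
  finally show ?thesis by (simp add: Y_def)
qed

section \<open>Real roots\<close>

definition weights :: "int \<Rightarrow> int \<Rightarrow> ('n::finite \<Rightarrow> int) set" where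
  "weights b r = {y \<in> UNIV \<rightarrow> {1..b}. b dvd r - sum y UNIV}"

text \<open>The linear factor is (t - sum y) / b. The type argument supplies the index type, which
  does not occur in \<open>real poly\<close>.\<close>

definition weight_poly :: "int \<Rightarrow> int \<Rightarrow> 'n::finite itself \<Rightarrow> real poly" where
  "weight_poly b r _ = (\<Sum>y\<in>(weights b r :: ('n \<Rightarrow> int) set).
     [:- of_int (sum y UNIV) / of_int b, 1 / of_int b:] ^ (CARD('n) - 1))"

lemma finite_weights: "finite (weights b r :: ('n::finite \<Rightarrow> int) set)"
  unfolding weights_def using finite_PiE[of UNIV "\<lambda>_ :: 'n. {1..b}"] by (simp add: PiE_UNIV_domain)

lemma poly_weight_poly:
  "poly (weight_poly b r TYPE('n::finite)) t =
    (\<Sum>y\<in>(weights b r :: ('n \<Rightarrow> int) set). ((t - of_int (sum y UNIV)) / of_int b) ^ (CARD('n) - 1))"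
  unfolding weight_poly_def by (simp add: poly_sum poly_power diff_divide_distrib algebra_simps)

lemma poly_pderiv_weight_poly:
  "poly (pderiv (weight_poly b r TYPE('n::finite))) t =
    real (CARD('n) - 1) / of_int b *
    (\<Sum>y\<in>(weights b r :: ('n \<Rightarrow> int) set). ((t - of_int (sum y UNIV)) / of_int b) ^ (CARD('n) - 2))"
proof (cases "CARD('n) - 1")
  \<comment> \<open>With a single label the truncated exponent is harmless: both sides
    vanish.\<close>
  case 0
  then show ?thesis
    unfolding weight_poly_def higher_pderiv_sum[of 1, simplified] by simp
next
  case (Suc k)
  then have "CARD('n) - 2 = k" by simp
  then show ?thesis
    unfolding weight_poly_def Suc higher_pderiv_sum[of 1, simplified]
    by (simp add: poly_sum pderiv_power_Suc pderiv_pCons poly_power diff_divide_distrib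
        sum_distrib_left algebra_simps del: of_nat_Suc power_Suc)
qed

text \<open>A residue class has infinitely many members beyond any bound, and a nonzero difference
  of polynomials has finitely many roots.\<close>

lemma poly_eq_if_eventually_at_residues:
  fixes p p' :: "real poly"
  assumes "b > 0" and "\<forall>\<^sub>F q in at_top. b dvd q - r \<longrightarrow> poly p (of_int q) = poly p' (of_int q)"
  shows "p = p'"
proof (rule ccontr)
  assume "p \<noteq> p'"
  then have "finite {t. poly (p - p') t = 0}" by (intro poly_roots_finite) simp
  moreover obtain Q where Q: "\<And>q. q \<ge> Q \<Longrightarrow> b dvd q - r \<Longrightarrow> poly p (of_int q) = poly p' (of_int q)"
    using assms(2) unfolding eventually_at_top_linorder by blast
  define f where "f k = real_of_int (r + b * (\<bar>Q\<bar> + \<bar>r\<bar> + int k))" for k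
  have "range f \<subseteq> {t. poly (p - p') t = 0}"
  proof (rule image_subsetI)
    fix k
    have "1 * (\<bar>Q\<bar> + \<bar>r\<bar> + int k) \<le> b * (\<bar>Q\<bar> + \<bar>r\<bar> + int k)"
      using assms(1) by (intro mult_right_mono) auto
    moreover have "Q - r \<le> 1 * (\<bar>Q\<bar> + \<bar>r\<bar> + int k)"
      using abs_ge_self[of Q] abs_ge_minus_self[of r] by simp
    ultimately have "Q \<le> r + b * (\<bar>Q\<bar> + \<bar>r\<bar> + int k)" by (metis diff_le_eq add.commute order_trans)
    from Q[OF this] show "f k \<in> {t. poly (p - p') t = 0}" by (simp add: f_def)
  qed
  moreover have "inj f" using assms(1) by (auto simp: inj_def f_def)
  ultimately show False
    using finite_subset range_inj_infinite by blast
qed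

text \<open>The count along one residue class already determines the polynomial. Since
  \<open>r\<close> is arbitrary, all the weight polynomials coincide, and \<open>r\<close> can later
  be chosen to expose a symmetry.\<close>

lemma characteristic_polynomial_eq_weight_poly:
  assumes "b > 0"
  shows "characteristic_polynomial (deformation_arrangement 0 b :: (real, 'n::{finite,linorder}) vec set set)
    = [:0, 1:] * weight_poly b r TYPE('n)"
proof (rule poly_eq_if_eventually_at_residues[OF assms, of r])
  let ?\<chi> = "characteristic_polynomial (deformation_arrangement 0 b :: (real, 'n) vec set set)"
  show "\<forall>\<^sub>F q in at_top. b dvd q - r \<longrightarrow>
      poly ?\<chi> (of_int q) = poly ([:0, 1:] * weight_poly b r TYPE('n)) (of_int q)"
    using characteristic_polynomial_eventually_counts[of 0 b, where 'n = 'n]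
      eventually_gt_at_top[of "int CARD('n) * b"]
  proof eventually_elim
    case (elim q)
    show ?case
    proof
      assume r: "b dvd q - r"
      have "0 < CARD('n)" by simp
      then have "1 \<le> int CARD('n)" by linarith
      then have "1 * b \<le> int CARD('n) * b" using assms by (intro mult_right_mono) auto
      then have q: "b < q" "0 < q" using elim(2) assms by linarith+
      have dvd: "b dvd q - s \<longleftrightarrow> b dvd r - s" for s
        using dvd_add_right_iff[OF r, of "r - s"] by simp
      then have W: "{y \<in> (UNIV :: 'n set) \<rightarrow> {1..b}. b dvd q - sum y UNIV} = weights b r"
        unfolding weights_def by simp
      have "real (card (based_colourings b q :: ('n \<Rightarrow> int) set)) =
          of_int (\<Sum>y\<in>(weights b r :: ('n \<Rightarrow> int) set). ((q - sum y UNIV) div b) ^ (CARD('n) - 1))"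
        using card_based_colourings[of b q, where 'n = 'n] assms elim(2) unfolding W by (metis of_int_of_nat_eq)
      also have "\<dots> = (\<Sum>y\<in>(weights b r :: ('n \<Rightarrow> int) set).
          ((of_int q - of_int (sum y UNIV)) / of_int b) ^ (CARD('n) - 1))"
        unfolding of_int_sum of_int_power
      proof (intro sum.cong refl arg_cong[where f = "\<lambda>z. z ^ _"])
        fix y :: "'n \<Rightarrow> int" assume "y \<in> weights b r"
        then have "b dvd q - sum y UNIV" unfolding weights_def using dvd by simp
        then show "real_of_int ((q - sum y UNIV) div b) = (of_int q - (\<Sum>i\<in>UNIV. of_int (y i))) / of_int b"
          by (simp add: real_of_int_div)
      qed
      finally have "real (card (based_colourings b q :: ('n \<Rightarrow> int) set))
          = poly (weight_poly b r TYPE('n)) (of_int q)"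
        unfolding poly_weight_poly .
      moreover have "real (card (proper_colourings 0 b q :: ('n \<Rightarrow> int) set))
          = of_int q * real (card (based_colourings b q :: ('n \<Rightarrow> int) set))"
        using card_proper_colourings_based[of b q, where 'n = 'n] assms q by simp
      ultimately show "poly ?\<chi> (of_int q) = poly ([:0, 1:] * weight_poly b r TYPE('n)) (of_int q)"
        using elim(1) by simp
    qed
  qed
qed

text \<open>Reversing the cells by \<open>q - 1 - x i\<close> keeps the range and negates all
  differences.\<close>

lemma card_proper_colourings_reflect:
  "card (proper_colourings (- d) (- c) q :: ('n::linorder \<Rightarrow> int) set)
    = card (proper_colourings c d q :: ('n \<Rightarrow> int) set)"
proof -
  have sub: "(\<lambda>i. q - 1 - x i) \<in> proper_colourings (- d) (- c) q"
    if "x \<in> proper_colourings c d q" for c d and x :: "'n \<Rightarrow> int"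
  proof -
    have "\<not> q dvd (q - 1 - x i) - (q - 1 - x j) - s" if "i < j" "- d \<le> s" "s \<le> - c" for i j s
    proof -
      have "\<not> q dvd x i - x j - (- s)"
        using \<open>x \<in> _\<close> that minus_le_iff[of d s] le_minus_iff[of s c]
        unfolding proper_colourings_def edges_def by blast
      moreover have "(q - 1 - x i) - (q - 1 - x j) - s = - (x i - x j - (- s))" by simp
      ultimately show ?thesis by (metis dvd_minus_iff)
    qed
    moreover have "0 \<le> x i \<and> x i < q" for i
      using \<open>x \<in> _\<close> by (auto simp: proper_colourings_def Pi_iff)
    then have "(\<lambda>i. q - 1 - x i) \<in> UNIV \<rightarrow> {0..<q}"
      by (intro Pi_I) (smt (verit) atLeastLessThan_iff)
    ultimately show ?thesis
      unfolding proper_colourings_def edges_def by blast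
  qed
  have "bij_betw (\<lambda>(x :: 'n \<Rightarrow> int) i. q - 1 - x i) (proper_colourings c d q) (proper_colourings (- d) (- c) q)"
    by (rule bij_betw_byWitness[where f' = "\<lambda>x i. q - 1 - x i"])
      (use sub[of _ c d] sub[of _ "- d" "- c"] in auto)
  then show ?thesis by (metis bij_betw_same_card)
qed

lemma characteristic_polynomial_reflect:
  "characteristic_polynomial (deformation_arrangement (- d) (- c) :: (real, 'n::{finite,linorder}) vec set set)
    = characteristic_polynomial (deformation_arrangement c d :: (real, 'n) vec set set)"
proof (rule poly_eq_if_eventually_at_residues[of 1 0])
  show "\<forall>\<^sub>F q in at_top. 1 dvd q - 0 \<longrightarrow>
      poly (characteristic_polynomial (deformation_arrangement (- d) (- c) :: (real, 'n) vec set set)) (of_int q)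
      = poly (characteristic_polynomial (deformation_arrangement c d :: (real, 'n) vec set set)) (of_int q)"
    using characteristic_polynomial_eventually_counts[of "- d" "- c", where 'n = 'n]
      characteristic_polynomial_eventually_counts[of c d, where 'n = 'n]
    by eventually_elim (simp add: card_proper_colourings_reflect)
qed simp

text \<open>The single entry at \<open>k\<close> adjusts the residue of the total; the other entries
  stay 1 so that they can be modified afterwards.\<close>

lemma weights_nonempty:
  assumes "b > 0"
  obtains y where "y \<in> (weights b r :: ('n::finite \<Rightarrow> int) set)" "\<And>i. i \<noteq> k \<Longrightarrow> y i = 1"
proof -
  define c where "c = (r - int CARD('n)) mod b + 1"
  define y where "y = (\<lambda>i :: 'n. if i = k then c else 1)"
  have c: "1 \<le> c" "c \<le> b"
    unfolding c_def using assms pos_mod_sign[OF assms, of "r - int CARD('n)"]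
      pos_mod_bound[OF assms, of "r - int CARD('n)"] by linarith+
  have "sum y UNIV = c + (\<Sum>i\<in>UNIV - {k}. 1)"
    unfolding y_def by (subst sum.remove[of _ k]) (auto intro!: sum.cong)
  also have "\<dots> = c + int CARD('n) - 1" by (simp add: of_nat_diff Suc_leI)
  finally have "r - sum y UNIV = (r - int CARD('n)) - (r - int CARD('n)) mod b"
    by (simp add: c_def)
  then have "b dvd r - sum y UNIV" by (simp add: minus_mod_eq_mult_div)
  then have "y \<in> weights b r" using c assms by (auto simp: weights_def y_def)
  then show ?thesis using that by (simp add: y_def)
qed

text \<open>Two members with totals differing by \<open>b\<close> exist, so not every total can
  equal \<open>t\<close>.\<close>

lemma weights_sum_neq:
  fixes t :: real
  assumes "b \<ge> 2" "CARD('n) \<ge> 3"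
  obtains y where "y \<in> (weights b r :: ('n::finite \<Rightarrow> int) set)" "of_int (sum y UNIV) \<noteq> t"
proof -
  obtain k :: 'n where True by blast
  have "card (UNIV - {k}) \<ge> 2" using assms by simp
  then obtain S where "S \<subseteq> UNIV - {k}" "card S = 2" by (metis obtain_subset_with_card_n)
  then obtain i j where ij: "i \<noteq> j" "i \<noteq> k" "j \<noteq> k" by (auto simp: card_2_iff)
  obtain y where y: "y \<in> weights b r" "\<And>l. l \<noteq> k \<Longrightarrow> y l = 1"
    using weights_nonempty[of b r k] assms by auto
  \<comment> \<open>Two entries equal to 1 are raised by \<open>b - 1\<close> and by 1, so the total
    grows by exactly \<open>b\<close> and keeps its residue. With \<open>k\<close> reserved, this
    takes three indices.\<close>
  define z where "z = y(i := b, j := 2)"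
  have "sum z UNIV = z i + (z j + sum z (UNIV - {i} - {j}))"
    using ij by (simp add: sum.remove[of UNIV i] sum.remove[of "UNIV - {i}" j])
  also have "sum z (UNIV - {i} - {j}) = sum y (UNIV - {i} - {j})"
    by (intro sum.cong) (auto simp: z_def)
  also have "z i + (z j + sum y (UNIV - {i} - {j})) = b + (y i + (y j + sum y (UNIV - {i} - {j})))"
    using ij y(2) by (simp add: z_def)
  also have "y i + (y j + sum y (UNIV - {i} - {j})) = sum y UNIV"
    using ij by (simp add: sum.remove[of UNIV i] sum.remove[of "UNIV - {i}" j])
  finally have sum: "sum z UNIV = b + sum y UNIV" .
  have "b dvd r - sum y UNIV" using y(1) by (simp add: weights_def)
  then have "b dvd r - sum z UNIV" unfolding sum by (metis diff_diff_eq2 diff_diff_eq add.commute dvd_diff dvd_refl)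
  then have "z \<in> weights b r" using y(1) assms by (auto simp: weights_def z_def Pi_iff)
  moreover have "real_of_int (sum z UNIV) \<noteq> t \<or> real_of_int (sum y UNIV) \<noteq> t"
    unfolding sum using assms by (simp only: of_int_add) linarith
  ultimately show ?thesis using that y(1) by blast
qed

text \<open>All terms are nonnegative and one is positive: any term when \<open>e\<close> is 0,
  otherwise one whose total differs from \<open>t\<close>.\<close>

lemma sum_weights_even_power_pos:
  fixes t :: real
  assumes "b > 0" "even e" "e = 0 \<or> b \<ge> 2 \<and> CARD('n) \<ge> 3"
  shows "0 < (\<Sum>y\<in>(weights b r :: ('n::finite \<Rightarrow> int) set). ((t - of_int (sum y UNIV)) / of_int b) ^ e)"
proof -
  obtain y where y: "y \<in> (weights b r :: ('n \<Rightarrow> int) set)" "e = 0 \<or> of_int (sum y UNIV) \<noteq> t"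
    using assms weights_nonempty[of b r] weights_sum_neq[of b r t] by metis
  show ?thesis
  proof (rule sum_pos2[OF finite_weights y(1)])
    show "0 < ((t - of_int (sum y UNIV)) / of_int b) ^ e"
      using y(2) assms by (subst zero_less_power_eq) auto
    show "0 \<le> ((t - of_int (sum y UNIV)) / of_int b) ^ e" for y :: "'n \<Rightarrow> int"
      using assms by (simp add: zero_le_even_power)
  qed
qed

section \<open>Monotonicity and symmetry for an even number of labels\<close>

lemma odd_power_strict_mono:
  fixes x y :: real
  assumes "odd e" "x < y"
  shows "x ^ e < y ^ e"
proof -
  have "x ^ e \<le> y ^ e" using assms by (intro power_mono_odd) auto
  moreover have "x ^ e \<noteq> y ^ e"
    using assms odd_real_root_power_cancel[of e x] odd_real_root_power_cancel[of e y] by auto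
  ultimately show ?thesis by simp
qed

lemma poly_weight_poly_strict_mono:
  assumes "b > 0" "even CARD('n)" "s < t"
  shows "poly (weight_poly b r TYPE('n::finite)) s < poly (weight_poly b r TYPE('n)) t"
  unfolding poly_weight_poly
proof (rule sum_strict_mono[OF finite_weights])
  show "(weights b r :: ('n \<Rightarrow> int) set) \<noteq> {}" using weights_nonempty[OF assms(1)] by blast
  show "((s - of_int (sum y UNIV)) / of_int b) ^ (CARD('n) - 1)
      < ((t - of_int (sum y UNIV)) / of_int b) ^ (CARD('n) - 1)" for y :: "'n \<Rightarrow> int"
    using assms by (intro odd_power_strict_mono) (auto simp: divide_strict_right_mono)
qed

text \<open>The reflection \<open>y \<mapsto> b + 1 - y\<close> sends the total \<open>s\<close> to \<open>n (b + 1) - s\<close>; it preserves the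
  residue class modulo \<open>b\<close> only for \<open>2 r \<equiv> n\<close>, which is why \<open>r = n / 2\<close> is chosen.\<close>

lemma poly_weight_poly_centre:
  assumes "b > 0" "even CARD('n)"
  shows "poly (weight_poly b (int CARD('n) div 2) TYPE('n::finite)) (real CARD('n) * (of_int b + 1) / 2) = 0"
proof -
  define c where "c = real CARD('n) * (of_int b + 1) / 2"
  define W where "W = (weights b (int CARD('n) div 2) :: ('n \<Rightarrow> int) set)"
  define R :: "('n \<Rightarrow> int) \<Rightarrow> ('n \<Rightarrow> int)" where "R y = (\<lambda>i. b + 1 - y i)" for y
  define g where "g y = ((c - of_int (sum y UNIV)) / of_int b) ^ (CARD('n) - 1)" for y :: "'n \<Rightarrow> int"
  have sumR: "sum (R y) UNIV = int CARD('n) * (b + 1) - sum y UNIV" for y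
    by (simp add: R_def sum_subtractf)
  have RW: "R y \<in> W" if "y \<in> W" for y
  proof -
    have "int CARD('n) = 2 * (int CARD('n) div 2)" using assms(2) by simp
    \<comment> \<open>Writing n = 2 r, the reflected total is congruent to 2 r - s modulo
      \<open>b\<close>, and r - (2 r - s) = -(r - s).\<close>
    then have "int CARD('n) div 2 - sum (R y) UNIV =
        - (int CARD('n) div 2 - sum y UNIV) - b * int CARD('n)"
      unfolding sumR by (simp add: algebra_simps)
    moreover have "b dvd int CARD('n) div 2 - sum y UNIV" using that by (simp add: W_def weights_def)
    ultimately have "b dvd int CARD('n) div 2 - sum (R y) UNIV"
      by (metis dvd_diff dvd_minus_iff dvd_triv_left)
    then show ?thesis using that by (auto simp: W_def weights_def R_def Pi_iff)
  qed
  have RR: "R (R y) = y" for y by (simp add: R_def)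
  have "bij_betw R W W" by (rule bij_betw_byWitness[where f' = R]) (auto simp: RR RW)
  then have "sum g W = (\<Sum>y\<in>W. g (R y))" by (rule sum.reindex_bij_betw[symmetric])
  also have "\<dots> = (\<Sum>y\<in>W. - g y)"
  proof (rule sum.cong[OF refl])
    fix y
    have "(c - of_int (sum (R y) UNIV)) / of_int b = - ((c - of_int (sum y UNIV)) / of_int b)"
      unfolding sumR c_def minus_divide_left by (simp add: algebra_simps)
    then show "g (R y) = - g y" unfolding g_def using assms by simp
  qed
  finally have "sum g W = 0" by (simp add: sum_negf)
  then show ?thesis unfolding poly_weight_poly c_def[symmetric] W_def[symmetric] g_def .
qed

theorem theorem5p1:
  fixes b :: int and A :: "(real, 'n::{finite,linorder}) vec set set"
  assumes "CARD('n) \<ge> 2"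
    and "b \<ge> int CARD('n) - 1"
    and "A = deformation_arrangement 0 b \<or> A = deformation_arrangement (- b) 0"
  shows "(odd CARD('n) \<longrightarrow>
            {t :: real. poly (characteristic_polynomial A) t = 0} = {0} \<and>
            order 0 (characteristic_polynomial A) = 1) \<and>
         (even CARD('n) \<longrightarrow>
            {t :: real. poly (characteristic_polynomial A) t = 0}
              = {0, real CARD('n) * (of_int b + 1) / 2} \<and>
            real CARD('n) * (of_int b + 1) / 2 \<noteq> 0 \<and>
            order 0 (characteristic_polynomial A) = 1 \<and>
            order (real CARD('n) * (of_int b + 1) / 2) (characteristic_polynomial A) = 1)"
proof -
  have b: "b > 0" using assms by linarith
  have \<chi>: "characteristic_polynomial A = [:0, 1:] * weight_poly b r TYPE('n)" for r
    using assms(3) characteristic_polynomial_eq_weight_poly[OF b, of r, where 'n = 'n]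
      characteristic_polynomial_reflect[of b 0, where 'n = 'n] by auto
  have order_X: "order 0 [:0, 1 :: real:] = 1" "order a [:0, 1 :: real:] = 0" if "a \<noteq> 0" for a
    using order_power_n_n[of "0 :: real" 1] that by (auto intro: order_0I)
  show ?thesis
  proof (cases "even CARD('n)")
    case False
    \<comment> \<open>Any residue would do here: the exponent is even for each of them.\<close>
    define f where "f = weight_poly b 0 TYPE('n)"
    have "CARD('n) \<ge> 3" using assms(1) False by (cases "CARD('n) = 2") auto
    then have pos: "0 < poly f t" for t
      unfolding f_def poly_weight_poly using assms False b
      by (intro sum_weights_even_power_pos) auto
    then have "poly f t \<noteq> 0" for t by (metis order.irrefl)
    moreover from this have "f \<noteq> 0" "order 0 f = 0" by (auto simp: order_root)
    ultimately show ?thesis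
      unfolding \<chi>[of 0] f_def[symmetric] using False order_X(1)[of 1] order_mult[of "[:0, 1:]" f 0]
      by auto
  next
    case True
    define f where "f = weight_poly b (int CARD('n) div 2) TYPE('n)"
    define c where "c = real CARD('n) * (of_int b + 1) / 2"
    have "c \<noteq> 0" using assms(1) b by (simp add: c_def)
    have root: "poly f c = 0"
      unfolding f_def c_def by (rule poly_weight_poly_centre[OF b True])
    have roots: "poly f t = 0 \<longleftrightarrow> t = c" for t
      using root poly_weight_poly_strict_mono[OF b True] unfolding f_def
      by (metis linorder_neqE order.irrefl)
    \<comment> \<open>For two labels \<open>b\<close> may be 1, but then the derivative has exponent
      0; with more labels the bound on \<open>b\<close> gives \<open>b \<ge> 2\<close>.\<close>
    have "CARD('n) - 2 = 0 \<or> b \<ge> 2 \<and> CARD('n) \<ge> 3"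
      using assms by linarith
    then have "0 < poly (pderiv f) c"
      unfolding f_def poly_pderiv_weight_poly using assms b True
      by (intro mult_pos_pos sum_weights_even_power_pos) auto
    then have pderiv: "pderiv f \<noteq> 0" "order c (pderiv f) = 0" by (auto intro: order_0I)
    then have "f \<noteq> 0" by auto
    have "order 0 f = 0" using roots[of 0] \<open>c \<noteq> 0\<close> by (intro order_0I) simp
    have "order c f \<noteq> 0" using root \<open>f \<noteq> 0\<close> by (simp add: order_root)
    \<comment> \<open>The derivative does not vanish at \<open>c\<close>, so the root is
      simple.\<close>
    then have "order c f = 1" using order_pderiv[of f c] pderiv root \<open>f \<noteq> 0\<close> by simp
    then have "order 0 ([:0, 1:] * f) = 1" "order c ([:0, 1:] * f) = 1"
      using \<open>order 0 f = 0\<close> \<open>f \<noteq> 0\<close> \<open>c \<noteq> 0\<close> order_X[of c]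
        order_mult[of "[:0, 1:]" f 0] order_mult[of "[:0, 1:]" f c] by auto
    moreover have "{t. poly ([:0, 1:] * f) t = 0} = {0, c}" using roots by auto
    ultimately show ?thesis
      unfolding \<chi>[of "int CARD('n) div 2"] f_def[symmetric] c_def[symmetric]
      using True \<open>c \<noteq> 0\<close> by blast
  qed
qed

end
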